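(* Let $Y=\{y\in\mathbb{R}^2 : h_i(y)\le 0,\ i=1,\dots,k\}$, where $h_1,\dots,h_k$ are real-valued functions on $\mathbb{R}^2$, and let $H(y)=\max_{1\le i\le k} h_i(y)$. Let the coordinates be chosen so that the minimum of $y_1$ over $Y$ and the minimum of $y_2$ over $Y$ are both equal to $0$. Let $\varphi\in[0,\pi/2]$ be given, let $u=(u_1,u_2)=(\cos\varphi,\sin\varphi)$, and let $t_*$ be a solution of the problem of minimizing $t$ over $t\ge 0$ subject to $H(u\cdot t)=0$. If the set $Y$ is convex, then this is sufficient for the point $y=u\cdot t_*$ to belong to $Y_*$, the Pareto solution set of the problem of minimizing $(y_1,y_2)$ over $Y$.
   Context: The vector optimization problem is to minimize both components $y_1,y_2$ of $y=(y_1,y_2)$ over $y\in Y\subseteq\mathbb{R}^2$; here $Y$ is the image of a feasible set $X\subseteq\mathbb{R}^n$ under two objective functions, $y_1=f_1(x)$, $y_2=f_2(x)$, and is described by the inequalities $h_i(y)\le 0$. Its solution is the set $Y_*$ of Pareto-optimal points of $Y$ (points of $Y_*$ are mutually incomparable in the sense of Pareto): a point $y_*=(y_{1*},y_{2*})\in Y$ belongs to $Y_*$ if and only if $K\cap Y=\{y_*\}$, where $K=\{y\in\mathbb{R}^2 : y_1\le y_{1*},\ y_2\le y_{2*}\}$ is the cone with top at $y_*$. The choice of coordinates means that the origin has been translated to the point whose coordinates are the minimal value of $y_1$ over $Y$ and the minimal value of $y_2$ over $Y$, so that $Y$ lies in the nonnegative quadrant.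
   Formalization: The functions h_1,…,h_k are additionally assumed continuous on R^2; for arbitrary real-valued h_i the claim is false (e.g. Y={y≥0, 1≤y_1+y_2≤4}, h=1 off Y, h=−1 on Y except h(1,1)=0, φ=π/4). *)

theory Defs
  imports "HOL-Analysis.Analysis"
begin

definition max_constraint :: "nat \<Rightarrow> (nat \<Rightarrow> real^2 \<Rightarrow> real) \<Rightarrow> real^2 \<Rightarrow> real" where
  "max_constraint k h y = Max ((\<lambda>i. h i y) ` {1..k})"

definition feasible_set :: "nat \<Rightarrow> (nat \<Rightarrow> real^2 \<Rightarrow> real) \<Rightarrow> (real^2) set" where
  "feasible_set k h = {y. \<forall>i\<in>{1..k}. h i y \<le> 0}"

text \<open>The value \<open>m\<close> is required to be attained on \<open>S\<close>; an infimum is not enough.\<close>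

definition is_minimum :: "('a \<Rightarrow> real) \<Rightarrow> 'a set \<Rightarrow> real \<Rightarrow> bool" where
  "is_minimum f S m \<longleftrightarrow> (\<exists>x. is_arg_min f (\<lambda>x. x \<in> S) x \<and> f x = m)"

definition dominance_cone :: "real^2 \<Rightarrow> (real^2) set" where
  "dominance_cone p = {y. y $ 1 \<le> p $ 1 \<and> y $ 2 \<le> p $ 2}"

definition pareto_set :: "(real^2) set \<Rightarrow> (real^2) set" where
  "pareto_set Y = {p \<in> Y. dominance_cone p \<inter> Y = {p}}"

definition direction :: "real \<Rightarrow> real^2" where
  "direction \<phi> = vector [cos \<phi>, sin \<phi>]"

end

theory Submission
  imports Defs
begin

text \<open>
  Points of \<open>Y\<close> have nonnegative coordinates, and two points of \<open>Y\<close> lie on the coordinate axes,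
  one on each. The proof rests on two observations.

  No point of the ray \<open>t *\<^sub>R u\<close> strictly before \<open>t_star\<close> belongs to \<open>Y\<close>
  (\<open>ray_avoids_before_first_zero\<close>). Since \<open>H\<close> has no zero there, such a point would satisfy
  \<open>H < 0\<close>; by the intermediate value theorem so would the origin, and by continuity a whole
  neighbourhood of the origin would lie in \<open>Y\<close>, in particular points with negative coordinates.

  Now suppose that some other point \<open>q\<close> of \<open>Y\<close> satisfies \<open>q \<le> t_star *\<^sub>R u\<close> componentwise.
  If \<open>q\<close> is on the ray, it is itself a point before \<open>t_star\<close>. Otherwise join \<open>q\<close> to the point of \<open>Y\<close> on the axis at the opposite side of the
  ray. By convexity the segment stays in \<open>Y\<close>, and it moves away from \<open>q\<close> with one coordinate
  strictly decreasing, so it meets the ray strictly before \<open>t_star\<close>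
  (\<open>segment_to_axis_meets_ray\<close>). Both cases contradict the first observation.
\<close>

lemma continuous_on_Max_finite:
  fixes f :: "'i \<Rightarrow> 'a::topological_space \<Rightarrow> real"
  assumes "finite I" "I \<noteq> {}" "\<And>i. i \<in> I \<Longrightarrow> continuous_on S (f i)"
  shows "continuous_on S (\<lambda>x. Max ((\<lambda>i. f i x) ` I))"
  using assms
proof (induction I rule: finite_ne_induct)
  case (singleton i)
  then show ?case by simp
next
  case (insert i I)
  then have "continuous_on S (\<lambda>x. max (f i x) (Max ((\<lambda>i. f i x) ` I)))"
    by (intro continuous_on_max) auto
  moreover have "Max ((\<lambda>i. f i x) ` insert i I) = max (f i x) (Max ((\<lambda>i. f i x) ` I))" for x
    using insert.hyps by simp
  ultimately show ?case by simp
qed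

lemma feasible_set_eq_sublevel:
  assumes "k \<ge> 1"
  shows "feasible_set k h = {y. max_constraint k h y \<le> 0}"
  using assms by (auto simp: feasible_set_def max_constraint_def)

text \<open>
  A sign change of \<open>H\<close> along the ray would produce a zero, and \<open>H\<close> cannot start negative at the
  origin because a sublevel set contained in a half-space through the origin does not have the
  origin in its interior.
\<close>

lemma ray_avoids_before_first_zero:
  fixes H :: "'a::euclidean_space \<Rightarrow> real" and u b :: 'a
  assumes cont: "continuous_on UNIV H"
    and half: "\<And>y. H y \<le> 0 \<Longrightarrow> 0 \<le> b \<bullet> y" and "b \<noteq> 0"
    and no_zero: "\<And>r. 0 \<le> r \<Longrightarrow> r < t \<Longrightarrow> H (r *\<^sub>R u) \<noteq> 0"
    and s: "0 \<le> s" "s < t"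
  shows "H (s *\<^sub>R u) > 0"
proof (rule ccontr)
  assume "\<not> H (s *\<^sub>R u) > 0"
  then have neg: "H (s *\<^sub>R u) < 0" using no_zero[OF s] by simp
  have along: "continuous_on {0..s} (\<lambda>r. H (r *\<^sub>R u))"
    by (intro continuous_on_compose2[OF cont] continuous_intros) auto
  have "H 0 < 0"
  proof (rule ccontr)
    assume "\<not> H 0 < 0"
    then obtain r where "0 \<le> r" "r \<le> s" "H (r *\<^sub>R u) = 0"
      using IVT2'[of "\<lambda>r. H (r *\<^sub>R u)" s 0 0] neg s(1) along by auto
    then show False using no_zero[of r] s(2) by simp
  qed
  moreover have "open {y. H y < 0}"
    using open_Collect_less[OF cont continuous_on_const] by simp
  ultimately obtain e where e: "e > 0" "\<And>y. dist y 0 < e \<Longrightarrow> H y < 0"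
    unfolding open_dist by auto
  define y where "y = (- (e / (2 * norm b))) *\<^sub>R b"
  have "norm y < e" using e(1) \<open>b \<noteq> 0\<close> by (simp add: y_def)
  then have "0 \<le> b \<bullet> y" using e(2)[of y] half[of y] by simp
  moreover have "b \<bullet> y < 0"
    using e(1) \<open>b \<noteq> 0\<close> by (simp add: y_def)
  ultimately show False by simp
qed

text \<open>
  The point \<open>a\<close> lies on the axis where coordinate \<open>i\<close> vanishes, while \<open>q\<close> lies strictly beyond the
  ray through \<open>u\<close> as seen from that axis. Hence the segment from \<open>q\<close> to \<open>a\<close> crosses the ray, and it
  leaves \<open>q\<close> before doing so, which makes coordinate \<open>i\<close> strictly smaller. Keeping
  the two coordinates \<open>i\<close> and \<open>j\<close> abstract covers both sides of the ray at once.
\<close>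

lemma segment_to_axis_meets_ray:
  fixes Y :: "(real^'n) set"
  assumes "convex Y" "q \<in> Y" "a \<in> Y"
    and coords: "UNIV = {i, j}"
    and a: "a $ i = 0" "0 \<le> a $ j"
    and q: "0 \<le> q $ i" "0 \<le> q $ j"
    and u: "0 \<le> u $ i" "0 \<le> u $ j"
    and side: "q $ j * u $ i < q $ i * u $ j"
  obtains s where "0 \<le> s" "s *\<^sub>R u \<in> Y" "s * u $ i < q $ i"
proof -
  \<comment> \<open>\<open>D\<close> and \<open>- A\<close> are the cross products of \<open>q\<close> and of \<open>a\<close> with \<open>u\<close>. The cross product with \<open>u\<close>
      is affine along the segment, so it vanishes at the point with weights \<open>A\<close> for \<open>q\<close> and \<open>D\<close> for \<open>a\<close>.\<close>
  define D where "D = q $ i * u $ j - q $ j * u $ i"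
  define A where "A = a $ j * u $ i"
  have D: "D > 0" using side by (simp add: D_def)
  have A: "A \<ge> 0" using a u by (simp add: A_def)
  have qi: "q $ i > 0"
  proof (rule ccontr)
    assume "\<not> q $ i > 0"
    then have "q $ i = 0" using q by simp
    then show False using side q u by (simp add: mult_less_0_iff)
  qed
  define s where "s = a $ j * q $ i / (D + A)"
  have "(A / (D + A)) *\<^sub>R q + (D / (D + A)) *\<^sub>R a \<in> Y"
    using D A by (intro convexD[OF assms(1-3)]) (auto simp: add.commute simp flip: add_divide_distrib)
  moreover have "(A / (D + A)) *\<^sub>R q + (D / (D + A)) *\<^sub>R a = s *\<^sub>R u"
  proof -
    have "((A / (D + A)) *\<^sub>R q + (D / (D + A)) *\<^sub>R a) $ l = (s *\<^sub>R u) $ l" for l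
    proof -
      have "l = i \<or> l = j" using coords by blast
      moreover have "A * q $ i = a $ j * q $ i * u $ i"
        "A * q $ j + D * a $ j = a $ j * q $ i * u $ j"
        by (simp_all add: A_def D_def algebra_simps)
      ultimately show ?thesis
        using a(1) by (auto simp: s_def simp flip: add_divide_distrib)
    qed
    then show ?thesis by (simp add: vec_eq_iff)
  qed
  ultimately have "s *\<^sub>R u \<in> Y" by simp
  moreover have "0 \<le> s" using a q D A by (simp add: s_def)
  moreover have "s * u $ i < q $ i"
  proof -
    have "s * u $ i = A / (D + A) * q $ i" by (simp add: s_def A_def)
    also have "\<dots> < 1 * q $ i"
      using D A qi by (intro mult_strict_right_mono) auto
    finally show ?thesis by simp
  qed
  ultimately show ?thesis using that by blast
qed

theorem mainTheorem1:
  fixes k :: nat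
    and h :: "nat \<Rightarrow> real^2 \<Rightarrow> real"
    and H :: "real^2 \<Rightarrow> real"
    and Y :: "(real^2) set"
    and \<phi> t_star :: real
    and u :: "real^2"
  assumes "k \<ge> 1"
    and "\<And>i. i \<in> {1..k} \<Longrightarrow> continuous_on UNIV (h i)"
    and "Y = feasible_set k h"
    and "H = max_constraint k h"
    and "is_minimum (\<lambda>y. y $ 1) Y 0"
    and "is_minimum (\<lambda>y. y $ 2) Y 0"
    and "\<phi> \<in> {0..pi/2}"
    and "u = direction \<phi>"
    and "is_arg_min (\<lambda>t. t) (\<lambda>t. t \<ge> 0 \<and> H (t *\<^sub>R u) = 0) t_star"
    and "convex Y"
  shows "t_star *\<^sub>R u \<in> pareto_set Y"
proof -
  have Y: "Y = {y. H y \<le> 0}"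
    using feasible_set_eq_sublevel[OF assms(1)] assms(3,4) by simp
  have contH: "continuous_on UNIV H"
    unfolding assms(4) max_constraint_def[abs_def]
    using assms(1,2) by (intro continuous_on_Max_finite) auto
  obtain a where a: "a \<in> Y" "a $ 1 = 0" and nn1: "\<And>y. y \<in> Y \<Longrightarrow> 0 \<le> y $ 1"
    using assms(5) unfolding is_minimum_def is_arg_min_linorder by auto
  obtain b where b: "b \<in> Y" "b $ 2 = 0" and nn2: "\<And>y. y \<in> Y \<Longrightarrow> 0 \<le> y $ 2"
    using assms(6) unfolding is_minimum_def is_arg_min_linorder by auto
  have u_nth: "u $ 1 = cos \<phi>" "u $ 2 = sin \<phi>"
    by (simp_all add: assms(8) direction_def)
  have u: "0 \<le> u $ 1" "0 \<le> u $ 2"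
    using assms(7) unfolding u_nth by (auto intro: cos_ge_zero sin_ge_zero)
  have unit: "u $ 1 * u $ 1 + u $ 2 * u $ 2 = 1"
    unfolding u_nth using sin_cos_squared_add3[of \<phi>] by simp
  have t: "0 \<le> t_star" "H (t_star *\<^sub>R u) = 0"
    and first: "\<And>r. 0 \<le> r \<Longrightarrow> H (r *\<^sub>R u) = 0 \<Longrightarrow> t_star \<le> r"
    using assms(9) unfolding is_arg_min_linorder by auto
  have before: "s *\<^sub>R u \<notin> Y" if "0 \<le> s" "s < t_star" for s
  proof -
    have "H (s *\<^sub>R u) > 0"
    proof (rule ray_avoids_before_first_zero[OF contH _ _ _ that, where b = "axis 1 1"])
      show "0 \<le> axis 1 1 \<bullet> y" if "H y \<le> 0" for y :: "real^2"
        using nn1[of y] that by (simp add: Y inner_axis')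
      show "axis 1 1 \<noteq> (0 :: real^2)" by (simp add: axis_eq_0_iff)
      show "H (r *\<^sub>R u) \<noteq> 0" if "0 \<le> r" "r < t_star" for r
        using first[of r] that by auto
    qed
    then show ?thesis by (simp add: Y)
  qed
  have "q = t_star *\<^sub>R u" if "q \<in> Y" and le: "q $ 1 \<le> t_star * u $ 1" "q $ 2 \<le> t_star * u $ 2" for q
  proof (cases "q $ 2 * u $ 1" "q $ 1 * u $ 2" rule: linorder_cases)
    case less
    obtain s where s: "0 \<le> s" "s *\<^sub>R u \<in> Y" "s * u $ 1 < q $ 1"
      using segment_to_axis_meets_ray[OF assms(10) \<open>q \<in> Y\<close> a(1) UNIV_2 a(2)]
        nn1 nn2 a \<open>q \<in> Y\<close> u less by metis
    have "s * u $ 1 < t_star * u $ 1" using s(3) le(1) by simp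
    then have "s < t_star" using u(1) by (simp add: mult_less_cancel_right)
    then show ?thesis using before s by blast
  next
    case greater
    have coords: "(UNIV :: 2 set) = {2, 1}" using UNIV_2 by auto
    obtain s where s: "0 \<le> s" "s *\<^sub>R u \<in> Y" "s * u $ 2 < q $ 2"
      using segment_to_axis_meets_ray[OF assms(10) \<open>q \<in> Y\<close> b(1) coords b(2)]
        nn1 nn2 b \<open>q \<in> Y\<close> u greater by metis
    have "s * u $ 2 < t_star * u $ 2" using s(3) le(2) by simp
    then have "s < t_star" using u(2) by (simp add: mult_less_cancel_right)
    then show ?thesis using before s by blast
  next
    case equal
    \<comment> \<open>\<open>q\<close> is parallel to the unit vector \<open>u\<close>, so it equals its projection onto the ray.\<close>
    define s where "s = q $ 1 * u $ 1 + q $ 2 * u $ 2"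
    have "s * u $ 1 = q $ 1 * (u $ 1 * u $ 1 + u $ 2 * u $ 2)"
      using equal by (simp add: s_def algebra_simps)
    moreover have "s * u $ 2 = q $ 2 * (u $ 1 * u $ 1 + u $ 2 * u $ 2)"
      using equal by (simp add: s_def algebra_simps)
    ultimately have q: "q = s *\<^sub>R u"
      unfolding unit by (simp add: vec_eq_iff forall_2)
    have "0 \<le> s" using nn1 nn2 \<open>q \<in> Y\<close> u by (simp add: s_def)
    have "s \<le> t_star * (u $ 1 * u $ 1 + u $ 2 * u $ 2)"
      using mult_right_mono[OF le(1) u(1)] mult_right_mono[OF le(2) u(2)]
      by (simp add: s_def algebra_simps)
    then have "s \<le> t_star" unfolding unit by simp
    moreover have "\<not> s < t_star" using before \<open>0 \<le> s\<close> \<open>q \<in> Y\<close> q by blast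
    ultimately show ?thesis using q by simp
  qed
  then show ?thesis
    using t by (auto simp: pareto_set_def dominance_cone_def Y)
qed

end
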